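(* Let $n\ge 2$ and let $K\subset\mathbb{R}^n$ be a convex, centrally symmetric body of volume $1$ in isotropic position. Let $X=(X_1,\dots,X_n)$ be uniformly distributed on $K$, and put $Y=X_1$, $Z=X_2$. For $(y,z)\in\mathbb{R}^2$ let $m(y,z)$ be the $(n-2)$-dimensional Lebesgue measure of $(\{(y,z)\}\times\mathbb{R}^{n-2})\cap K$. Then for any measurable functions $f,g:\mathbb{R}\to\mathbb{R}$ such that $f(Y)$, $g(Z)$ and $f(Y)g(Z)$ are integrable, $$\operatorname{cov}(f(Y),g(Z))=\int_{\{(y,\bar y,z,\bar z)\in\mathbb{R}^4:\ |y|>|\bar y|,\ |z|>|\bar z|\}}\big(m(y,z)m(\bar y,\bar z)-m(y,\bar z)m(\bar y,z)\big)\big(f(y)-f(\bar y)\big)\big(g(z)-g(\bar z)\big)\,dy\,d\bar y\,dz\,d\bar z .$$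
   Context: $K$ of volume $1$ is in isotropic position if, for $X$ uniformly distributed on $K$, $\mathbb{E}X_i=0$ and $\mathbb{E}X_iX_j=L_K^2\delta_{ij}$ for all $i,j$, for some constant $L_K>0$. $K$ is regarded as a probability space with Lebesgue measure restricted to $K$. $\operatorname{cov}(U,V)=\mathbb{E}(UV)-\mathbb{E}U\,\mathbb{E}V$. For $n=2$, $m$ is the indicator function of $K$. *)

theory Defs
  imports "HOL-Analysis.Analysis"
begin

definition covariance :: "'a measure \<Rightarrow> ('a \<Rightarrow> real) \<Rightarrow> ('a \<Rightarrow> real) \<Rightarrow> real" where
  "covariance M U V =
     (LINT x|M. U x * V x) - (LINT x|M. U x) * (LINT x|M. V x)"

definition centrally_symmetric :: "'a::real_vector set \<Rightarrow> bool" where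
  "centrally_symmetric K \<longleftrightarrow> (\<forall>x\<in>K. - x \<in> K)"

text \<open>
  Meant for sets \<open>K\<close> of volume 1, so that \<open>lebesgue_on K\<close> is the uniform distribution on \<open>K\<close>
  and the integrals below are expectations. All integrands are bounded when \<open>K\<close> is bounded.
\<close>
definition isotropic_position :: "(real ^ 'n) set \<Rightarrow> bool" where
  "isotropic_position K \<longleftrightarrow>
     (\<forall>i. (LINT x|lebesgue_on K. x $ i) = 0) \<and>
     (\<exists>L>0. \<forall>i j. (LINT x|lebesgue_on K. x $ i * x $ j) = (if i = j then L\<^sup>2 else 0))"

text \<open>
  The section of \<open>K\<close> by \<open>x $ i = y\<close> and \<open>x $ j = z\<close> is parametrised by the remaining
  coordinates, and measured by the product of one copy of \<open>lborel\<close> for each of them, which is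
  Lebesgue measure in dimension \<open>n - 2\<close> (on Borel sets; sections of a compact set are compact).
  If \<open>i\<close> and \<open>j\<close> are the only coordinates, this product is a unit point mass, so that
  \<open>section_measure K i j\<close> is the indicator function of \<open>K\<close> in the coordinates \<open>i\<close>, \<open>j\<close>.
\<close>
definition section_measure :: "(real ^ 'n) set \<Rightarrow> 'n \<Rightarrow> 'n \<Rightarrow> real \<Rightarrow> real \<Rightarrow> real" where
  "section_measure K i j y z =
     measure (Pi\<^sub>M (UNIV - {i, j}) (\<lambda>_. lborel :: real measure))
       {w \<in> extensional (UNIV - {i, j}).
          (\<chi> k. if k = i then y else if k = j then z else w k) \<in> K}"

end

theory Submission imports Defs begin

text \<open>
  The function \<open>m\<close> is the joint density of \<open>Y = X\<^sub>i\<close> and \<open>Z = X\<^sub>j\<close>. For any joint density \<open>m\<close> let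
  \<open>(Y', Z')\<close> be an independent copy of \<open>(Y, Z)\<close>. Expanding the product gives Hoeffding's identity
  \<open>E[(f(Y) - f(Y')) * (g(Z) - g(Z'))] = 2 * cov(f(Y), g(Z))\<close>,
  which in terms of densities says that the integral of
  \<open>A(y, y', z, z') = m y z * m y' z' * (f y - f y') * (g z - g z')\<close> over four-dimensional space is twice
  the covariance. Exchanging \<open>y\<close> and \<open>y'\<close> preserves Lebesgue measure, replaces the weight
  \<open>m y z * m y' z'\<close> by \<open>m y' z * m y z'\<close> and changes the sign of \<open>f y - f y'\<close>. Hence the integrand
  \<open>h\<close>, which carries the determinant of the two weights, is \<open>A\<close> plus its image under this exchange, and
  its integral over the whole space is four times the covariance.

  Moreover \<open>h\<close> is unchanged by exchanging \<open>y\<close> and \<open>y'\<close>, and by exchanging \<open>z\<close> and \<open>z'\<close>, since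
  each of these changes the sign of the determinant and of one difference. These two exchanges
  generate four images of the region \<open>\<bar>y\<bar> > \<bar>y'\<bar>, \<bar>z\<bar> > \<bar>z'\<bar>\<close>, which are disjoint and fill the space up
  to the null set where \<open>\<bar>y\<bar> = \<bar>y'\<bar>\<close> or \<open>\<bar>z\<bar> = \<bar>z'\<bar>\<close>. So each of them carries a quarter of the integral,
  that is, the covariance. This is \<open>covariance_density_ordered_abs\<close>.

  That \<open>m\<close> is the joint density is Fubini's theorem in the coordinates \<open>i\<close>, \<open>j\<close> and the rest
  (\<open>distr_two_coordinates_eq_section_density\<close>). The functions \<open>f\<close> and \<open>g\<close> are only Lebesgue
  measurable; they are replaced by Borel functions that agree with them almost everywhere. The
  replacement affects only null sets, because coordinate projections pull null sets back to null
  sets.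
\<close>

section \<open>Borel measurability and null sets in products\<close>

lemma borel_measurable_fst [measurable (raw)]:
  fixes h :: "'c \<Rightarrow> 'a::second_countable_topology \<times> 'b::second_countable_topology"
  shows "h \<in> borel_measurable M \<Longrightarrow> (\<lambda>x. fst (h x)) \<in> borel_measurable M"
  by (simp add: borel_prod[symmetric])

lemma borel_measurable_snd [measurable (raw)]:
  fixes h :: "'c \<Rightarrow> 'a::second_countable_topology \<times> 'b::second_countable_topology"
  shows "h \<in> borel_measurable M \<Longrightarrow> (\<lambda>x. snd (h x)) \<in> borel_measurable M"
  by (simp add: borel_prod[symmetric])

lemma emeasure_lborel_Times:
  fixes A :: "'a::euclidean_space set" and B :: "'b::euclidean_space set"
  assumes "A \<in> sets borel" "B \<in> sets borel"
  shows "emeasure lborel (A \<times> B) = emeasure lborel A * emeasure lborel B"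
  using assms by (simp add: lborel_prod[symmetric] lborel.emeasure_pair_measure_Times)

lemma AE_lborel_fst:
  assumes "AE x in (lborel :: 'a::euclidean_space measure). P x"
  shows "AE p in (lborel :: ('a \<times> 'b::euclidean_space) measure). P (fst p)"
proof -
  from assms obtain N where N: "{x. \<not> P x} \<subseteq> N" "N \<in> null_sets lborel"
    by (auto elim!: AE_E simp: null_sets_def)
  have "N \<times> (UNIV :: 'b set) \<in> null_sets (lborel \<Otimes>\<^sub>M lborel)"
    using N(2) by (intro lborel.times_in_null_sets1) auto
  then have "N \<times> (UNIV :: 'b set) \<in> null_sets lborel" by (simp add: lborel_prod)
  then show ?thesis by (rule AE_I') (use N(1) in auto)
qed

lemma AE_lborel_snd:
  assumes "AE x in (lborel :: 'b::euclidean_space measure). P x"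
  shows "AE p in (lborel :: ('a::euclidean_space \<times> 'b) measure). P (snd p)"
proof -
  from assms obtain N where N: "{x. \<not> P x} \<subseteq> N" "N \<in> null_sets lborel"
    by (auto elim!: AE_E simp: null_sets_def)
  have "(UNIV :: 'a set) \<times> N \<in> null_sets (lborel \<Otimes>\<^sub>M lborel)"
    using N(2) by (intro lborel.times_in_null_sets2) auto
  then have "(UNIV :: 'a set) \<times> N \<in> null_sets lborel" by (simp add: lborel_prod)
  then show ?thesis by (rule AE_I') (use N(1) in auto)
qed

lemma AE_lborel_abs_neq: "AE x in lborel. \<bar>y\<bar> \<noteq> \<bar>x :: real\<bar>"
proof -
  have "{y, - y} \<in> null_sets lborel" by (rule finite_imp_null_set_lborel) auto
  then show ?thesis by (rule AE_I') (auto simp: abs_eq_iff)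
qed

lemma AE_lborel_pair:
  assumes "Measurable.pred borel P"
    and "\<And>x. AE y in lborel. P (x, y)"
  shows "AE p in (lborel :: ('a::euclidean_space \<times> 'b::euclidean_space) measure). P p"
proof -
  have "{p \<in> space (lborel \<Otimes>\<^sub>M lborel). P p} \<in> sets (lborel \<Otimes>\<^sub>M lborel :: ('a \<times> 'b) measure)"
    unfolding lborel_prod using assms(1) by (simp add: pred_def)
  then have "AE p in lborel \<Otimes>\<^sub>M lborel. P p"
    by (rule lborel_pair.AE_pair_measure) (use assms(2) in auto)
  then show ?thesis by (simp only: lborel_prod)
qed

section \<open>Rearrangements of the four coordinates\<close>

type_synonym real4 = "real \<times> real \<times> real \<times> real"

text \<open>
  Lebesgue measure is determined by its values on boxes, and boxes are products of Borel sets. In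
  this form the hypothesis is immediate for a map that only permutes coordinates: the preimage of
  a product is the product of the same factors in another order.
\<close>
lemma distr_lborel_real4I:
  fixes T :: "'a::euclidean_space \<Rightarrow> real4"
  assumes [measurable]: "T \<in> borel_measurable borel"
    and T: "\<And>A B C E. A \<in> sets borel \<Longrightarrow> B \<in> sets borel \<Longrightarrow> C \<in> sets borel \<Longrightarrow> E \<in> sets borel \<Longrightarrow>
      emeasure lborel (T -` (A \<times> B \<times> C \<times> E)) =
      emeasure lborel A * emeasure lborel B * emeasure lborel C * emeasure lborel E"
  shows "distr lborel borel T = lborel"
proof (rule lborel_eqI[symmetric])
  fix l u :: real4
  assume le: "\<And>b. b \<in> Basis \<Longrightarrow> l \<bullet> b \<le> u \<bullet> b"
  obtain a1 a2 a3 a4 where l: "l = (a1, a2, a3, a4)" by (metis prod.exhaust)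
  obtain b1 b2 b3 b4 where u: "u = (b1, b2, b3, b4)" by (metis prod.exhaust)
  have box: "box l u = box a1 b1 \<times> box a2 b2 \<times> box a3 b3 \<times> box a4 b4"
    by (simp add: l u box_prod)
  have "emeasure (distr lborel borel T) (box l u) = emeasure lborel (T -` box l u)"
    by (subst emeasure_distr) auto
  also have "\<dots> = emeasure lborel (box l u)"
    unfolding box by (subst T) (simp_all add: emeasure_lborel_Times borel_Times mult.assoc
      del: emeasure_lborel_box)
  also have "\<dots> = (\<Prod>b\<in>Basis. (u - l) \<bullet> b)"
    using le by (rule emeasure_lborel_box)
  finally show "emeasure (distr lborel borel T) (box l u) = (\<Prod>b\<in>Basis. (u - l) \<bullet> b)" .
qed simp

text \<open>
  Two independent copies of \<open>(Y, Z)\<close> give the pair of pairs \<open>((y, z), (y', z'))\<close>; the domain of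
  the integral groups the first coordinates and the second coordinates.
\<close>
definition interleave :: "(real \<times> real) \<times> (real \<times> real) \<Rightarrow> real4" where
  "interleave = (\<lambda>((y, z), (y', z')). (y, y', z, z'))"

definition swap_first :: "real4 \<Rightarrow> real4" where
  "swap_first = (\<lambda>(y, y', z, z'). (y', y, z, z'))"

definition swap_second :: "real4 \<Rightarrow> real4" where
  "swap_second = (\<lambda>(y, y', z, z'). (y, y', z', z))"

lemma measurable_interleave [measurable]: "interleave \<in> borel_measurable borel"
  unfolding interleave_def case_prod_beta by measurable

lemma measurable_swap_first [measurable]: "swap_first \<in> borel_measurable borel"
  unfolding swap_first_def case_prod_beta by measurable

lemma measurable_swap_second [measurable]: "swap_second \<in> borel_measurable borel"
  unfolding swap_second_def case_prod_beta by measurable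

lemma distr_interleave: "distr lborel borel interleave = lborel"
proof (rule distr_lborel_real4I)
  fix A B C E :: "real set"
  assume [measurable]: "A \<in> sets borel" "B \<in> sets borel" "C \<in> sets borel" "E \<in> sets borel"
  have "interleave -` (A \<times> B \<times> C \<times> E) = (A \<times> C) \<times> (B \<times> E)"
    by (auto simp: interleave_def)
  then show "emeasure lborel (interleave -` (A \<times> B \<times> C \<times> E)) =
      emeasure lborel A * emeasure lborel B * emeasure lborel C * emeasure lborel E"
    by (simp add: emeasure_lborel_Times borel_Times mult_ac)
qed measurable

lemma distr_swap_first: "distr lborel borel swap_first = lborel"
proof (rule distr_lborel_real4I)
  fix A B C E :: "real set"
  assume [measurable]: "A \<in> sets borel" "B \<in> sets borel" "C \<in> sets borel" "E \<in> sets borel"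
  have "swap_first -` (A \<times> B \<times> C \<times> E) = B \<times> A \<times> C \<times> E"
    by (auto simp: swap_first_def)
  then show "emeasure lborel (swap_first -` (A \<times> B \<times> C \<times> E)) =
      emeasure lborel A * emeasure lborel B * emeasure lborel C * emeasure lborel E"
    by (simp add: emeasure_lborel_Times borel_Times mult_ac)
qed measurable

lemma distr_swap_second: "distr lborel borel swap_second = lborel"
proof (rule distr_lborel_real4I)
  fix A B C E :: "real set"
  assume [measurable]: "A \<in> sets borel" "B \<in> sets borel" "C \<in> sets borel" "E \<in> sets borel"
  have "swap_second -` (A \<times> B \<times> C \<times> E) = A \<times> B \<times> E \<times> C"
    by (auto simp: swap_second_def)
  then show "emeasure lborel (swap_second -` (A \<times> B \<times> C \<times> E)) =
      emeasure lborel A * emeasure lborel B * emeasure lborel C * emeasure lborel E"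
    by (simp add: emeasure_lborel_Times borel_Times mult_ac)
qed measurable

lemma has_bochner_integral_lborel_invariant:
  fixes F :: "'b::euclidean_space \<Rightarrow> real" and T :: "'a::euclidean_space \<Rightarrow> 'b"
  assumes T: "T \<in> borel_measurable borel" "distr lborel borel T = lborel"
    and F: "F \<in> borel_measurable borel"
  shows "has_bochner_integral lborel (\<lambda>x. F (T x)) c \<longleftrightarrow> has_bochner_integral lborel F c"
proof -
  have "has_bochner_integral lborel F c \<longleftrightarrow> has_bochner_integral (distr lborel borel T) F c"
    by (simp add: T(2))
  also have "\<dots> \<longleftrightarrow> has_bochner_integral lborel (\<lambda>x. F (T x)) c"
    using T(1) F by (simp add: has_bochner_integral_iff integrable_distr_eq integral_distr)
  finally show ?thesis by simp
qed

text \<open>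
  This is the independence of the two copies of \<open>(Y, Z)\<close>: it is applied to functions \<open>u\<close>, \<open>v\<close> that
  each contain a factor \<open>m\<close>.
\<close>
lemma has_bochner_integral_lborel_tensor:
  fixes u :: "'a::euclidean_space \<Rightarrow> real" and v :: "'b::euclidean_space \<Rightarrow> real"
  assumes u: "integrable lborel u" and v: "integrable lborel v"
  shows "has_bochner_integral lborel (\<lambda>p. u (fst p) * v (snd p))
    ((LINT x|lborel. u x) * (LINT x|lborel. v x))"
proof -
  have int: "integrable (lborel \<Otimes>\<^sub>M lborel) (\<lambda>p. u (fst p) * v (snd p))"
    using u v by (intro lborel_pair.Fubini_integrable) (auto simp: abs_mult)
  then have "(LINT p|(lborel \<Otimes>\<^sub>M lborel). u (fst p) * v (snd p)) =
     (LINT x|lborel. LINT y|lborel. u x * v y)"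
    by (subst lborel_pair.integral_fst'[symmetric]) auto
  then show ?thesis using int by (simp add: has_bochner_integral_iff lborel_prod)
qed

section \<open>The covariance formula for an arbitrary joint density\<close>

definition ordered_abs :: "real4 set" where
  "ordered_abs = {(y, y', z, z'). \<bar>y\<bar> > \<bar>y'\<bar> \<and> \<bar>z\<bar> > \<bar>z'\<bar>}"

lemma sets_ordered_abs [measurable]: "ordered_abs \<in> sets borel"
  unfolding ordered_abs_def case_prod_beta by measurable

text \<open>
  Almost every point has exactly one of its four images under the two exchanges in
  \<open>ordered_abs\<close>, so an invariant function has a quarter of its integral there.
\<close>
lemma has_bochner_integral_ordered_abs:
  assumes H: "has_bochner_integral lborel H c"
    and first: "\<And>p. H (swap_first p) = H p" and second: "\<And>p. H (swap_second p) = H p"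
  shows "has_bochner_integral lborel (\<lambda>p. indicator ordered_abs p * H p :: real) (c / 4)"
proof -
  define G where "G p = indicator ordered_abs p * H p" for p
  have Hm [measurable]: "H \<in> borel_measurable borel"
    using H by (auto simp: has_bochner_integral_iff)
  have Gm [measurable]: "G \<in> borel_measurable borel" unfolding G_def by measurable
  have "integrable lborel G"
    using integrable_mult_indicator[of ordered_abs lborel H] H
    by (simp add: G_def[abs_def] has_bochner_integral_iff)
  then obtain d where G: "has_bochner_integral lborel G d"
    using has_bochner_integral_integrable by blast
  note inv = has_bochner_integral_lborel_invariant
  have G1: "has_bochner_integral lborel (\<lambda>p. G (swap_first p)) d"
    using G by (subst inv) (auto simp: distr_swap_first)
  have G2: "has_bochner_integral lborel (\<lambda>p. G (swap_second p)) d"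
    using G by (subst inv) (auto simp: distr_swap_second)
  have G12: "has_bochner_integral lborel (\<lambda>p. G (swap_first (swap_second p))) d"
    using G1 by (subst inv[where T = swap_second and F = "\<lambda>p. G (swap_first p)"])
      (auto simp: distr_swap_second)
  have ae1: "AE p in (lborel :: real4 measure). \<bar>fst p\<bar> \<noteq> \<bar>fst (snd p)\<bar>"
    by (rule AE_lborel_pair) (auto intro: AE_lborel_fst AE_lborel_abs_neq)
  have "AE q in (lborel :: (real \<times> real) measure). \<bar>fst q\<bar> \<noteq> \<bar>snd q\<bar>"
    by (rule AE_lborel_pair) (auto intro: AE_lborel_abs_neq)
  from AE_lborel_snd[OF AE_lborel_snd[OF this]]
  have ae2: "AE p in (lborel :: real4 measure). \<bar>fst (snd (snd p))\<bar> \<noteq> \<bar>snd (snd (snd p))\<bar>" .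
  have "AE p in lborel. G p + G (swap_first p) + G (swap_second p)
      + G (swap_first (swap_second p)) = H p"
    using ae1 ae2
  proof eventually_elim
    case (elim p)
    obtain y y' z z' where p: "p = (y, y', z, z')" by (metis prod.exhaust)
    show ?case
      using elim by (simp add: G_def first second)
        (auto simp: p ordered_abs_def swap_first_def swap_second_def indicator_def)
  qed
  moreover have sum: "has_bochner_integral lborel (\<lambda>p. G p + G (swap_first p) + G (swap_second p)
      + G (swap_first (swap_second p))) (d + d + d + d)"
    by (intro has_bochner_integral_add G G1 G2 G12)
  ultimately have "has_bochner_integral lborel H (d + d + d + d)"
    by (subst has_bochner_integral_cong_AE[symmetric]) (auto intro: borel_measurable_has_bochner_integral)
  with H have "c = d + d + d + d" by (rule has_bochner_integral_eq)
  with G show ?thesis by (simp add: G_def[abs_def])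
qed

text \<open>
  The first factor is the \<open>2 \<times> 2\<close> minor of the kernel \<open>m\<close> with rows \<open>y, y'\<close> and columns \<open>z, z'\<close>.
\<close>
definition weighted_minor :: "(real \<Rightarrow> real \<Rightarrow> real) \<Rightarrow> (real \<Rightarrow> real) \<Rightarrow> (real \<Rightarrow> real) \<Rightarrow> real4 \<Rightarrow> real" where
  "weighted_minor m f g = (\<lambda>(y, y', z, z').
     (m y z * m y' z' - m y z' * m y' z) * (f y - f y') * (g z - g z'))"

text \<open>
  Each of the two terms of the minor contributes \<open>2 * (c - a * b)\<close> to the integral over the whole
  space, by Hoeffding's identity: in the second term the negative sign is absorbed by reversing the
  difference of \<open>f\<close>. Symmetry then leaves a quarter of the total on \<open>ordered_abs\<close>.
\<close>
lemma covariance_density_ordered_abs: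
  fixes m :: "real \<Rightarrow> real \<Rightarrow> real"
  assumes m [measurable]: "(\<lambda>q. m (fst q) (snd q)) \<in> borel_measurable borel"
    and f [measurable]: "f \<in> borel_measurable borel" and g [measurable]: "g \<in> borel_measurable borel"
    and I: "has_bochner_integral lborel (\<lambda>q. m (fst q) (snd q)) 1"
    and If: "has_bochner_integral lborel (\<lambda>q. m (fst q) (snd q) * f (fst q)) a"
    and Ig: "has_bochner_integral lborel (\<lambda>q. m (fst q) (snd q) * g (snd q)) b"
    and Ifg: "has_bochner_integral lborel (\<lambda>q. m (fst q) (snd q) * (f (fst q) * g (snd q))) c"
  shows "has_bochner_integral lborel (\<lambda>p. indicator ordered_abs p * weighted_minor m f g p) (c - a * b)"
proof -
  define A :: "real4 \<Rightarrow> real"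
    where "A = (\<lambda>(y, y', z, z'). m y z * m y' z' * ((f y - f y') * (g z - g z')))"
  have Am [measurable]: "A \<in> borel_measurable borel"
  proof -
    have [measurable]: "(\<lambda>p. m (k p) (l p)) \<in> borel_measurable borel"
      if [measurable]: "k \<in> borel_measurable borel" "l \<in> borel_measurable borel"
      for k l :: "real4 \<Rightarrow> real"
      using measurable_compose[of "\<lambda>p. (k p, l p)" borel borel, OF _ m] by simp
    show ?thesis unfolding A_def case_prod_beta by measurable
  qed
  have tensor: "has_bochner_integral lborel (\<lambda>p. u (fst p) * v (snd p)) (s * t)"
    if "has_bochner_integral lborel u s" "has_bochner_integral lborel v t"
    for u v :: "real \<times> real \<Rightarrow> real" and s t
    using has_bochner_integral_lborel_tensor[of u v] that by (simp add: has_bochner_integral_iff)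
  have "has_bochner_integral lborel (\<lambda>p. A (interleave p)) (c * 1 - a * b - b * a + 1 * c)"
  proof -
    have eq: "(\<lambda>p. A (interleave p)) = (\<lambda>p.
        m (fst (fst p)) (snd (fst p)) * (f (fst (fst p)) * g (snd (fst p))) * m (fst (snd p)) (snd (snd p))
      - m (fst (fst p)) (snd (fst p)) * f (fst (fst p)) * (m (fst (snd p)) (snd (snd p)) * g (snd (snd p)))
      - m (fst (fst p)) (snd (fst p)) * g (snd (fst p)) * (m (fst (snd p)) (snd (snd p)) * f (fst (snd p)))
      + m (fst (fst p)) (snd (fst p)) * (m (fst (snd p)) (snd (snd p)) * (f (fst (snd p)) * g (snd (snd p)))))"
      by (auto simp: A_def interleave_def fun_eq_iff algebra_simps)
    show ?thesis unfolding eq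
      by (intro has_bochner_integral_add has_bochner_integral_diff
        tensor[OF Ifg I] tensor[OF If Ig] tensor[OF Ig If] tensor[OF I Ifg])
  qed
  then have A: "has_bochner_integral lborel A (2 * (c - a * b))"
    by (subst (asm) has_bochner_integral_lborel_invariant)
      (auto simp: distr_interleave algebra_simps)
  then have A': "has_bochner_integral lborel (\<lambda>p. A (swap_first p)) (2 * (c - a * b))"
    by (subst has_bochner_integral_lborel_invariant) (auto simp: distr_swap_first)
  have "weighted_minor m f g = (\<lambda>p. A p + A (swap_first p))"
    by (auto simp: fun_eq_iff A_def weighted_minor_def swap_first_def algebra_simps)
  with has_bochner_integral_add[OF A A']
  have "has_bochner_integral lborel (weighted_minor m f g) (4 * (c - a * b))" by simp
  then have "has_bochner_integral lborel (\<lambda>p. indicator ordered_abs p * weighted_minor m f g p)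
      (4 * (c - a * b) / 4)"
    by (rule has_bochner_integral_ordered_abs)
      (auto simp: weighted_minor_def swap_first_def swap_second_def split: prod.splits, algebra+)
  then show ?thesis by (simp only: nonzero_mult_div_cancel_left[of 4])
qed

section \<open>The joint density of two coordinates\<close>

lemma borel_measurable_vec_lambda [measurable (raw)]:
  fixes h :: "'a \<Rightarrow> 'n::finite \<Rightarrow> real"
  assumes "\<And>k. (\<lambda>x. h x k) \<in> borel_measurable M"
  shows "(\<lambda>x. \<chi> k. h x k) \<in> borel_measurable M"
  unfolding borel_measurable_euclidean_space[of "\<lambda>x. \<chi> k. h x k"]
  using assms by (auto simp: Basis_vec_def inner_axis)

lemma borel_measurable_vec_nth [measurable (raw)]:
  fixes h :: "'a \<Rightarrow> real ^ 'n"
  assumes "h \<in> borel_measurable M"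
  shows "(\<lambda>x. h x $ k) \<in> borel_measurable M"
proof -
  have "(\<lambda>x. h x \<bullet> axis k 1) \<in> borel_measurable M"
    using assms by measurable
  then show ?thesis by (simp add: inner_axis)
qed

text \<open>
  The general description of Lebesgue measure as a product measure is indexed by the standard
  basis. Indexing by the coordinates themselves is what lets single coordinates be split off, in
  the form that \<open>section_measure\<close> has.
\<close>
lemma lborel_vec_eq_distr_PiM:
  "(lborel :: (real ^ 'n) measure) = distr (Pi\<^sub>M UNIV (\<lambda>_. lborel)) borel (\<lambda>w. \<chi> k. w k)"
proof (rule lborel_eqI)
  interpret product_sigma_finite "\<lambda>_::'n. lborel :: real measure" ..
  fix l u :: "real ^ 'n"
  assume le: "\<And>b. b \<in> Basis \<Longrightarrow> l \<bullet> b \<le> u \<bullet> b"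
  have le': "l $ k \<le> u $ k" for k
    using le[of "axis k 1"] by (simp add: inner_axis axis_in_Basis_iff)
  have "emeasure (distr (Pi\<^sub>M UNIV (\<lambda>_. lborel)) borel (\<lambda>w. \<chi> k. w k)) (box l u) =
      emeasure (Pi\<^sub>M UNIV (\<lambda>_::'n. lborel)) (\<Pi>\<^sub>E k\<in>UNIV. box (l $ k) (u $ k))"
    by (subst emeasure_distr)
      (auto intro!: arg_cong2[where f = emeasure] simp: mem_box_cart space_PiM PiE_iff box_real)
  also have "\<dots> = (\<Prod>k\<in>UNIV. ennreal (u $ k - l $ k))"
    using le' by (subst emeasure_PiM) auto
  also have "\<dots> = ennreal (\<Prod>k\<in>UNIV. (u - l) $ k)"
    using le' by (subst prod_ennreal) auto
  also have "(\<Prod>k\<in>UNIV. (u - l) $ k) = (\<Prod>b\<in>Basis. (u - l) \<bullet> b)"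
  proof -
    have inj: "inj (\<lambda>k::'n. axis k (1::real))" by (auto simp: inj_on_def axis_eq_axis)
    have "(Basis :: (real ^ 'n) set) = range (\<lambda>k. axis k 1)" by (auto simp: Basis_vec_def)
    then have "(\<Prod>b\<in>Basis. (u - l) \<bullet> b) = (\<Prod>b\<in>range (\<lambda>k. axis k 1). (u - l) \<bullet> b)"
      by (rule arg_cong)
    also have "\<dots> = (\<Prod>k\<in>UNIV. (u - l) $ k)"
      by (subst prod.reindex[OF inj]) (simp add: inner_axis)
    finally show ?thesis by simp
  qed
  finally show "emeasure (distr (Pi\<^sub>M UNIV (\<lambda>_. lborel)) borel (\<lambda>w. \<chi> k. w k)) (box l u) =
      ennreal (\<Prod>b\<in>Basis. (u - l) \<bullet> b)" .
qed simp

lemma nn_integral_lborel_split_coordinate: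
  fixes F :: "real ^ 'n \<Rightarrow> ennreal"
  assumes [measurable]: "F \<in> borel_measurable borel"
  shows "(\<integral>\<^sup>+x. F x \<partial>lborel) =
    (\<integral>\<^sup>+y. \<integral>\<^sup>+w. F (\<chi> k. if k = i then y else w k) \<partial>Pi\<^sub>M (UNIV - {i}) (\<lambda>_. lborel) \<partial>lborel)"
proof -
  interpret product_sigma_finite "\<lambda>_::'n. lborel :: real measure" ..
  have ins: "insert i (UNIV - {i}) = UNIV" by auto
  have "(\<integral>\<^sup>+x. F x \<partial>lborel) =
      (\<integral>\<^sup>+w. F (\<chi> k. w k) \<partial>Pi\<^sub>M (insert i (UNIV - {i})) (\<lambda>_. lborel))"
    unfolding ins by (subst lborel_vec_eq_distr_PiM) (simp add: nn_integral_distr)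
  also have "\<dots> = (\<integral>\<^sup>+y. \<integral>\<^sup>+w. F (\<chi> k. (w(i := y)) k) \<partial>Pi\<^sub>M (UNIV - {i}) (\<lambda>_. lborel) \<partial>lborel)"
    by (subst product_nn_integral_insert_rev) (auto simp: ins)
  finally show ?thesis by (simp add: fun_upd_def)
qed

lemma nn_integral_lborel_split_two_coordinates:
  fixes F :: "real ^ 'n \<Rightarrow> ennreal"
  assumes F [measurable]: "F \<in> borel_measurable borel" and ij: "i \<noteq> j"
  shows "(\<integral>\<^sup>+x. F x \<partial>lborel) =
    (\<integral>\<^sup>+y. \<integral>\<^sup>+z. \<integral>\<^sup>+w. F (\<chi> k. if k = i then y else if k = j then z else w k)
      \<partial>Pi\<^sub>M (UNIV - {i, j}) (\<lambda>_. lborel) \<partial>lborel \<partial>lborel)"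
proof -
  interpret product_sigma_finite "\<lambda>_::'n. lborel :: real measure" ..
  have ins: "UNIV - {i} = insert j (UNIV - {i, j})" using ij by auto
  have "(\<integral>\<^sup>+w. F (\<chi> k. if k = i then y else w k) \<partial>Pi\<^sub>M (UNIV - {i}) (\<lambda>_. lborel)) =
      (\<integral>\<^sup>+z. \<integral>\<^sup>+w. F (\<chi> k. if k = i then y else (w(j := z)) k)
        \<partial>Pi\<^sub>M (UNIV - {i, j}) (\<lambda>_. lborel) \<partial>lborel)" for y
  proof -
    have [measurable]: "(\<lambda>w. if k = i then y else w k) \<in>
        borel_measurable (Pi\<^sub>M (insert j (UNIV - {i, j})) (\<lambda>_. lborel))" for k
      by (cases "k = i") auto
    show ?thesis unfolding ins by (subst product_nn_integral_insert_rev) auto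
  qed
  then show ?thesis
    by (simp add: nn_integral_lborel_split_coordinate[OF F, of i] fun_upd_def cong: if_cong)
qed

text \<open>
  A null set \<open>N\<close> of values of one coordinate gives a cylinder of measure \<open>0 \<cdot> \<infinity> = 0\<close>.
\<close>
lemma AE_lborel_vec_nth:
  assumes "AE y in lborel. P y"
  shows "AE x in (lborel :: (real ^ 'n) measure). P (x $ i)"
proof -
  from assms obtain N where N: "{y. \<not> P y} \<subseteq> N" "N \<in> null_sets lborel"
    by (auto elim!: AE_E simp: null_sets_def)
  then have [measurable]: "N \<in> sets borel" by auto
  have ind: "indicator N (x $ i) = (indicator {x. x $ i \<in> N} x :: ennreal)" for x :: "real ^ 'n"
    by (simp add: indicator_def)
  have "emeasure lborel {x :: real ^ 'n. x $ i \<in> N} =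
      (\<integral>\<^sup>+x. indicator N (x $ i) \<partial>(lborel :: (real ^ 'n) measure))"
    unfolding ind by (rule nn_integral_indicator[symmetric]) measurable
  also have "\<dots> = (\<integral>\<^sup>+y. indicator N y * emeasure (Pi\<^sub>M (UNIV - {i}) (\<lambda>_. lborel))
      (space (Pi\<^sub>M (UNIV - {i}) (\<lambda>_::'n. lborel :: real measure))) \<partial>lborel)"
    by (subst nn_integral_lborel_split_coordinate[of _ i]) auto
  also have "\<dots> = 0"
    using N(2) by (subst nn_integral_multc) (auto simp: null_sets_def)
  finally have "{x :: real ^ 'n. x $ i \<in> N} \<in> null_sets lborel"
    by (auto intro!: null_setsI)
  then show ?thesis by (rule AE_I') (use N(1) in auto)
qed

text \<open>
  The real-valued \<open>measure\<close> gives the value 0 to sets of infinite measure. For bounded \<open>K\<close> the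
  sections lie in a cube, so \<open>section_measure\<close> is their true measure.
\<close>
lemma emeasure_section_finite:
  fixes K :: "(real ^ 'n) set"
  assumes "bounded K"
  shows "emeasure (Pi\<^sub>M (UNIV - {i, j}) (\<lambda>_. lborel :: real measure))
       {w \<in> extensional (UNIV - {i, j}).
          (\<chi> k. if k = i then y else if k = j then z else w k) \<in> K} < \<infinity>" (is "emeasure ?P ?S < _")
proof -
  interpret product_sigma_finite "\<lambda>_::'n. lborel :: real measure" ..
  obtain B where B: "\<And>x. x \<in> K \<Longrightarrow> norm x \<le> B" using assms by (auto simp: bounded_iff)
  have "?S \<subseteq> (\<Pi>\<^sub>E k\<in>UNIV - {i, j}. {- B..B})"
  proof
    fix w assume w: "w \<in> ?S"
    have "\<bar>w k\<bar> \<le> B" if "k \<notin> {i, j}" for k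
      using B[of "\<chi> k. if k = i then y else if k = j then z else w k"] that w
        component_le_norm_cart[of "\<chi> k. if k = i then y else if k = j then z else w k" k] by auto
    with w show "w \<in> (\<Pi>\<^sub>E k\<in>UNIV - {i, j}. {- B..B})"
      by (auto simp: PiE_iff abs_le_iff) (metis minus_le_iff)
  qed
  then have "emeasure ?P ?S \<le> emeasure ?P (\<Pi>\<^sub>E k\<in>UNIV - {i, j}. {- B..B})"
    by (rule emeasure_mono) auto
  also have "\<dots> = (\<Prod>k\<in>UNIV - {i, j}. emeasure lborel {- B..B})"
    by (subst emeasure_PiM) auto
  also have "\<dots> = ennreal (\<Prod>k\<in>UNIV - {i, j}. measure lborel {- B..B})"
    by (subst prod_ennreal[symmetric]) (auto simp: emeasure_lborel_Icc_eq emeasure_eq_ennreal_measure)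
  also have "\<dots> < \<infinity>" by simp
  finally show ?thesis .
qed

text \<open>
  By Fubini, integrating out the coordinates other than \<open>i\<close> and \<open>j\<close> over the points of \<open>K\<close>
  that lie above \<open>(y, z)\<close> leaves the measure of the section. Measurability of the section
  measure is that of the slices of the set \<open>Q\<close> below, which is \<open>K\<close> in the coordinates
  \<open>((y, z), w)\<close>.
\<close>
lemma distr_two_coordinates_eq_section_density:
  fixes K :: "(real ^ 'n) set"
  assumes ij: "i \<noteq> j" and K [measurable]: "K \<in> sets borel" and bdd: "bounded K"
  shows "(\<lambda>q. section_measure K i j (fst q) (snd q)) \<in> borel_measurable borel" (is ?meas)
    and "distr (density lborel (indicator K)) borel (\<lambda>x. (x $ i, x $ j)) =
      density lborel (\<lambda>q. ennreal (section_measure K i j (fst q) (snd q)))" (is ?distr)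
proof -
  interpret product_sigma_finite "\<lambda>_::'n. lborel :: real measure" ..
  define P where "P = Pi\<^sub>M (UNIV - {i, j}) (\<lambda>_. lborel :: real measure)"
  interpret P: sigma_finite_measure P unfolding P_def by (rule sigma_finite) auto
  define S where "S q = {w \<in> extensional (UNIV - {i, j}).
      (\<chi> k. if k = i then fst q else if k = j then snd q else w k) \<in> K}" for q :: "real \<times> real"
  have fin: "emeasure P (S q) < \<infinity>" for q
    unfolding P_def S_def using bdd by (rule emeasure_section_finite)
  have em: "ennreal (section_measure K i j (fst q) (snd q)) = emeasure P (S q)" for q
    using fin[of q] by (simp add: section_measure_def P_def S_def emeasure_eq_ennreal_measure)
  have [measurable]: "(\<lambda>p. if k = i then fst (fst p) else if k = j then snd (fst p) else snd p k)
      \<in> borel_measurable (borel \<Otimes>\<^sub>M P)" for k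
    unfolding P_def by (cases "k = i"; cases "k = j") auto
  define Q where "Q = {p \<in> space (borel \<Otimes>\<^sub>M P).
      (\<chi> k. if k = i then fst (fst p) else if k = j then snd (fst p) else snd p k) \<in> K}"
  have Q: "Q \<in> sets (borel \<Otimes>\<^sub>M P)" unfolding Q_def by measurable
  have slice: "Pair q -` Q = S q" for q
    by (auto simp: Q_def S_def P_def space_pair_measure space_PiM PiE_def cong: if_cong)
  have S [measurable]: "S q \<in> sets P" for q
    using sets_Pair1[OF Q, of q] by (simp add: slice)
  have emm [measurable]: "(\<lambda>q. emeasure P (S q)) \<in> borel_measurable borel"
    using P.measurable_emeasure_Pair[OF Q] by (simp add: slice)
  show ?meas
  proof -
    have "section_measure K i j (fst q) (snd q) = enn2real (emeasure P (S q))" for q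
      by (simp add: section_measure_def P_def S_def measure_def)
    then show ?thesis by simp
  qed
  show ?distr
  proof (rule measure_eqI)
    fix A assume "A \<in> sets (distr (density lborel (indicator K)) borel (\<lambda>x. (x $ i, x $ j)))"
    then have A [measurable]: "A \<in> sets borel" by simp
    let ?v = "\<lambda>(y::real) (z::real) (w::'n \<Rightarrow> real). \<chi> k. if k = i then y else if k = j then z else w k"
    have vm [measurable]: "(\<lambda>w. ?v y z w) \<in> borel_measurable P" for y z
    proof (rule borel_measurable_vec_lambda)
      show "(\<lambda>w. if k = i then y else if k = j then z else w k) \<in> borel_measurable P" for k
        unfolding P_def by (cases "k = i"; cases "k = j") auto
    qed
    have "emeasure (distr (density lborel (indicator K)) borel (\<lambda>x. (x $ i, x $ j))) A =
        (\<integral>\<^sup>+x. indicator K x * indicator A (x $ i, x $ j) \<partial>lborel)"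
    proof -
      have "(\<lambda>x :: real ^ 'n. (x $ i, x $ j)) \<in> borel_measurable borel" by measurable
      from measurable_sets[OF this A]
      have [measurable]: "(\<lambda>x :: real ^ 'n. (x $ i, x $ j)) -` A \<in> sets borel" by simp
      show ?thesis
        by (subst emeasure_distr, simp, simp, subst emeasure_density)
          (auto simp: indicator_def intro!: nn_integral_cong)
    qed
    also have "\<dots> = (\<integral>\<^sup>+y. \<integral>\<^sup>+z. \<integral>\<^sup>+w. indicator K (?v y z w) * indicator A (y, z) \<partial>P \<partial>lborel \<partial>lborel)"
      using ij by (subst nn_integral_lborel_split_two_coordinates[OF _ ij]) (auto simp: P_def)
    also have "\<dots> = (\<integral>\<^sup>+y. \<integral>\<^sup>+z. emeasure P (S (y, z)) * indicator A (y, z) \<partial>lborel \<partial>lborel)"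
    proof (intro nn_integral_cong)
      fix y z :: real
      have "(\<integral>\<^sup>+w. indicator K (?v y z w) * indicator A (y, z) \<partial>P) =
          (\<integral>\<^sup>+w. indicator (S (y, z)) w * indicator A (y, z) \<partial>P)"
        by (intro nn_integral_cong) (auto simp: S_def P_def space_PiM PiE_def indicator_def cong: if_cong)
      also have "\<dots> = emeasure P (S (y, z)) * indicator A (y, z)"
        by (subst nn_integral_multc) auto
      finally show "(\<integral>\<^sup>+w. indicator K (?v y z w) * indicator A (y, z) \<partial>P) =
          emeasure P (S (y, z)) * indicator A (y, z)" .
    qed
    also have "\<dots> = (\<integral>\<^sup>+q. emeasure P (S q) * indicator A q \<partial>(lborel \<Otimes>\<^sub>M lborel))"
    proof (rule lborel.nn_integral_fst)
      have "(\<lambda>q. emeasure P (S q) * indicator A q) \<in> borel_measurable borel" by measurable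
      then show "(\<lambda>q. emeasure P (S q) * indicator A q) \<in> borel_measurable (lborel \<Otimes>\<^sub>M lborel)"
        by (simp add: lborel_prod)
    qed
    also have "\<dots> = emeasure (density lborel
        (\<lambda>q. ennreal (section_measure K i j (fst q) (snd q)))) A"
      unfolding em lborel_prod by (simp add: emeasure_density)
    finally show "emeasure (distr (density lborel (indicator K)) borel (\<lambda>x. (x $ i, x $ j))) A =
        emeasure (density lborel (\<lambda>q. ennreal (section_measure K i j (fst q) (snd q)))) A" .
  qed simp
qed

text \<open>
  For Borel \<open>\<phi>\<close> the passage from Lebesgue to Borel sets changes no integral; what remains is the
  change of variables to the law of \<open>(X\<^sub>i, X\<^sub>j)\<close>.
\<close>
lemma has_bochner_integral_lebesgue_on_two_coordinates:
  fixes K :: "(real ^ 'n) set" and \<phi> :: "real \<times> real \<Rightarrow> real"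
  assumes ij: "i \<noteq> j" and K [measurable]: "K \<in> sets borel" and bdd: "bounded K"
    and \<phi> [measurable]: "\<phi> \<in> borel_measurable borel"
  shows "has_bochner_integral (lebesgue_on K) (\<lambda>x. \<phi> (x $ i, x $ j)) c \<longleftrightarrow>
    has_bochner_integral lborel (\<lambda>q. section_measure K i j (fst q) (snd q) * \<phi> q) c"
proof -
  note [measurable] = distr_two_coordinates_eq_section_density(1)[OF ij K bdd]
  have nonneg: "0 \<le> section_measure K i j y z" for y z
    by (simp add: section_measure_def)
  have "has_bochner_integral (lebesgue_on K) (\<lambda>x. \<phi> (x $ i, x $ j)) c \<longleftrightarrow>
      has_bochner_integral lborel (\<lambda>x. indicator K x * \<phi> (x $ i, x $ j)) c"
    by (simp add: has_bochner_integral_iff integrable_restrict_space integral_restrict_space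
      integrable_completion integral_completion)
  also have "\<dots> \<longleftrightarrow> has_bochner_integral (density lborel (indicat_real K)) (\<lambda>x. \<phi> (x $ i, x $ j)) c"
    by (simp add: has_bochner_integral_iff integrable_real_density integral_real_density)
  also have "\<dots> \<longleftrightarrow> has_bochner_integral
      (distr (density lborel (indicator K)) borel (\<lambda>x. (x $ i, x $ j))) \<phi> c"
    by (simp add: has_bochner_integral_iff integrable_distr_eq integral_distr ennreal_indicator)
  also have "\<dots> \<longleftrightarrow> has_bochner_integral lborel (\<lambda>q. section_measure K i j (fst q) (snd q) * \<phi> q) c"
    unfolding distr_two_coordinates_eq_section_density(2)[OF ij K bdd]
    by (simp add: has_bochner_integral_iff integrable_real_density integral_real_density nonneg)
  finally show ?thesis .
qed

section \<open>The covariance formula for a convex body\<close>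

theorem theorem2p1:
  fixes K :: "(real ^ 'n) set"
    and i j :: 'n
    and f g :: "real \<Rightarrow> real"
    and m :: "real \<Rightarrow> real \<Rightarrow> real"
    and D :: "(real \<times> real \<times> real \<times> real) set"
    and h :: "real \<times> real \<times> real \<times> real \<Rightarrow> real"
  assumes "i \<noteq> j"
    and "convex K" and "compact K" and "interior K \<noteq> {}"
    and "centrally_symmetric K"
    and "measure lebesgue K = 1"
    and "isotropic_position K"
    and "f \<in> borel_measurable lebesgue" and "g \<in> borel_measurable lebesgue"
    and "integrable (lebesgue_on K) (\<lambda>x. f (x $ i))"
    and "integrable (lebesgue_on K) (\<lambda>x. g (x $ j))"
    and "integrable (lebesgue_on K) (\<lambda>x. f (x $ i) * g (x $ j))"
  defines "m \<equiv> section_measure K i j"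
    and "D \<equiv> {(y, y', z, z'). \<bar>y\<bar> > \<bar>y'\<bar> \<and> \<bar>z\<bar> > \<bar>z'\<bar>}"
    and "h \<equiv> \<lambda>(y, y', z, z').
           (m y z * m y' z' - m y z' * m y' z) * (f y - f y') * (g z - g z')"
  shows "set_integrable lebesgue D h \<and>
    covariance (lebesgue_on K) (\<lambda>x. f (x $ i)) (\<lambda>x. g (x $ j)) =
      (LINT p:D|lebesgue. h p)"
proof -
  from assms have ij: "i \<noteq> j" and K: "compact K" by auto
  have Kb [measurable]: "K \<in> sets borel" using K by (intro borel_compact)
  have Kl: "K \<inter> space lebesgue \<in> sets lebesgue" using Kb by auto
  note integral_iff = has_bochner_integral_lebesgue_on_two_coordinates[OF ij Kb compact_imp_bounded[OF K]]
  obtain f' g' where f' [measurable]: "f' \<in> borel_measurable borel" and ff: "AE x in lborel. f x = f' x"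
    and g' [measurable]: "g' \<in> borel_measurable borel" and gg: "AE x in lborel. g x = g' x"
    using completion_ex_borel_measurable_real[of f lborel] completion_ex_borel_measurable_real[of g lborel] assms
    by auto
  have fK: "AE x in lebesgue_on K. f (x $ i) = f' (x $ i)"
    unfolding AE_restrict_space_iff[OF Kl] AE_completion_iff
    using AE_lborel_vec_nth[OF ff, of i] by eventually_elim simp
  have gK: "AE x in lebesgue_on K. g (x $ j) = g' (x $ j)"
    unfolding AE_restrict_space_iff[OF Kl] AE_completion_iff
    using AE_lborel_vec_nth[OF gg, of j] by eventually_elim simp
  have borelK: "\<phi> \<in> borel_measurable borel \<Longrightarrow> \<phi> \<in> borel_measurable (lebesgue_on K)"
    for \<phi> :: "real ^ 'n \<Rightarrow> real"
    by (intro measurable_restrict_space1 measurable_completion) simp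
  define a b c where "a = (LINT x|lebesgue_on K. f (x $ i))" and "b = (LINT x|lebesgue_on K. g (x $ j))"
    and "c = (LINT x|lebesgue_on K. f (x $ i) * g (x $ j))"
  have transfer: "has_bochner_integral (lebesgue_on K) \<phi>' (LINT x|lebesgue_on K. \<phi> x)"
    if "integrable (lebesgue_on K) \<phi>" "AE x in lebesgue_on K. \<phi> x = \<phi>' x" "\<phi>' \<in> borel_measurable borel"
    for \<phi> \<phi>' :: "real ^ 'n \<Rightarrow> real"
    using has_bochner_integral_integrable[OF that(1)] that(2) borelK[OF that(3)]
    by (subst has_bochner_integral_cong_AE[symmetric, OF borel_measurable_integrable[OF that(1)]]) auto
  have I: "has_bochner_integral lborel (\<lambda>q. m (fst q) (snd q)) 1"
  proof -
    interpret finite_measure "lebesgue_on K"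
      by (rule finite_measure_lebesgue_on) (rule lmeasurable_compact[OF K])
    have "measure (lebesgue_on K) (space (lebesgue_on K)) = 1"
      using assms Kl by (simp add: measure_restrict_space)
    with lebesgue_integral_const[of "lebesgue_on K" "1 :: real"]
    have "(LINT x|lebesgue_on K. 1 :: real) = 1" by (simp only: real_scaleR_def mult_1_right)
    then have "has_bochner_integral (lebesgue_on K) (\<lambda>x. 1) (1 :: real)"
      unfolding has_bochner_integral_iff using integrable_const by blast
    then show ?thesis using integral_iff[of "\<lambda>_. 1" 1] by (simp add: m_def)
  qed
  have If: "has_bochner_integral lborel (\<lambda>q. m (fst q) (snd q) * f' (fst q)) a"
    unfolding m_def a_def using transfer[of "\<lambda>x. f (x $ i)" "\<lambda>x. f' (x $ i)"] fK assms
    by (subst integral_iff[symmetric]) auto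
  have Ig: "has_bochner_integral lborel (\<lambda>q. m (fst q) (snd q) * g' (snd q)) b"
    unfolding m_def b_def using transfer[of "\<lambda>x. g (x $ j)" "\<lambda>x. g' (x $ j)"] gK assms
    by (subst integral_iff[symmetric]) auto
  have "AE x in lebesgue_on K. f (x $ i) * g (x $ j) = f' (x $ i) * g' (x $ j)"
    using fK gK by eventually_elim simp
  then have Ifg: "has_bochner_integral lborel (\<lambda>q. m (fst q) (snd q) * (f' (fst q) * g' (snd q))) c"
    unfolding m_def c_def using transfer[of "\<lambda>x. f (x $ i) * g (x $ j)" "\<lambda>x. f' (x $ i) * g' (x $ j)"] assms
    by (subst integral_iff[symmetric]) auto
  have mm: "(\<lambda>q. m (fst q) (snd q)) \<in> borel_measurable borel"
    unfolding m_def by (rule distr_two_coordinates_eq_section_density(1)[OF ij Kb compact_imp_bounded[OF K]])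
  let ?H = "\<lambda>p. indicator D p * weighted_minor m f' g' p"
  have "D = ordered_abs" by (auto simp: D_def ordered_abs_def)
  with covariance_density_ordered_abs[OF mm f' g' I If Ig Ifg]
  have H: "has_bochner_integral lborel ?H (c - a * b)" by simp
  then have Hm: "?H \<in> borel_measurable lborel" by (rule borel_measurable_has_bochner_integral)
  have Hl: "has_bochner_integral lebesgue ?H (c - a * b)"
    using H Hm by (simp add: has_bochner_integral_iff integrable_completion integral_completion)
  \<comment> \<open>Points \<open>p = (y, y', z, z')\<close> with an exceptional value of \<open>f\<close> or \<open>g\<close> in one of the coordinates form a null set.\<close>
  have "AE p in lborel. ?H p = indicator D p * h p"
    using AE_lborel_fst[OF ff] AE_lborel_snd[OF AE_lborel_fst[OF ff]]
      AE_lborel_snd[OF AE_lborel_snd[OF AE_lborel_fst[OF gg]]]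
      AE_lborel_snd[OF AE_lborel_snd[OF AE_lborel_snd[OF gg]]]
    by eventually_elim (auto simp: h_def weighted_minor_def split: prod.splits)
  then have eq: "AE p in lebesgue. ?H p = indicator D p * h p" by (rule AE_completion)
  have "has_bochner_integral lebesgue (\<lambda>p. indicator D p * h p) (c - a * b)"
    using Hl eq borel_measurable_AE[OF measurable_completion[OF Hm] eq]
    by (subst has_bochner_integral_cong_AE[symmetric, OF measurable_completion[OF Hm]]) auto
  then show ?thesis
    by (simp add: set_integrable_def set_lebesgue_integral_def has_bochner_integral_iff
      covariance_def a_def b_def c_def)
qed

end
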